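(* For every $n\times n$ matrix $L$ ($n\ge 2$) with non-negative integer entries and zero diagonal, the recursive procedure $\mathsf{A}$ described below outputs exactly the set $\min\mathcal{D}_{\ge 0}(L)$. Procedure $\mathsf{A}(L)$: If $n=2$, $L=\begin{pmatrix}0&a\\ b&0\end{pmatrix}$, output $\min\{(d,\max(1,\lceil ab/d\rceil)) \mid d\in\mathbb{N}_+,\ d\le\max(1,ab)\}$. If $n\ge 3$: (1) for each $s\in\{1,\ldots,n\}$ compute recursively $\tilde A_s=\mathsf{A}(L_s)$; (2) let $A_s=\{\tilde{\mathbf{d}}_s \mid \tilde{\mathbf{d}}\in\tilde A_s\}$; (3) for each tuple $(\boldsymbol\delta_1,\ldots,\boldsymbol\delta_n)\in A_1\times\cdots\times A_n$, let $\mathbf{d}$ be the componentwise maximum of $\boldsymbol\delta_1,\ldots,\boldsymbol\delta_n$; (4) compute the set $E_{\mathbf d}$ of minimal vectors $\mathbf{e}\ge\mathbf{d}$ in $\mathbb{N}_+^n$ such that all proper principal minors of $\mathrm{Diag}(\mathbf{e})-L$ are positive (equivalently, all non-constant coefficients of $\det(\mathrm{Diag}(X+\mathbf{e})-L)$ are positive); (5) for each $\mathbf{e}\in E_{\mathbf d}$, compute the minimal vectors $\mathbf{e}'\ge\mathbf{e}$ such that $\det(\mathrm{Diag}(\mathbf{e}')-L)\ge 0$; (6) output the set of minimal elements of the union, over all tuples in (3) and all $\mathbf{e}$ in (4), of the vectors found in (5).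
   Context: $\mathbb{N}_+$ denotes the positive integers. A real square Z-matrix (off-diagonal entries $\le 0$) is an almost non-singular $M$-matrix if all its proper principal minors are positive and its determinant is non-negative. $\mathcal{D}_{\ge 0}(L)=\{\mathbf{d}\in\mathbb{N}_+^n \mid \mathrm{Diag}(\mathbf{d})-L \text{ is an almost non-singular } M\text{-matrix}\}$. For $S\subseteq\mathbb{N}^n$, $\min S$ denotes its set of minimal elements under the componentwise order ($\mathbf{x}\le\mathbf{y}$ iff $x_i\le y_i$ for all $i$). $L_s$ is the matrix obtained from $L$ by deleting its $s$-th row and column. For $\mathbf{d}\in\mathbb{Z}^{n-1}$ and $1\le s\le n$, $\mathbf{d}_s\in\mathbb{Z}^n$ is obtained by inserting the entry $1$ at position $s$: $\mathbf{d}_s[i]=\mathbf{d}[i]$ for $i<s$, $\mathbf{d}_s[s]=1$, $\mathbf{d}_s[i]=\mathbf{d}[i-1]$ for $i>s$. $X=(x_1,\ldots,x_n)$ is a vector of variables. *)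

theory Defs
  imports
    "HOL-Library.FuncSet"
    "Jordan_Normal_Form.Determinant"
    "Jordan_Normal_Form.DL_Submatrix"
begin

text \<open>
  Throughout, indices are 0-based, as in \<open>Jordan_Normal_Form\<close>. The order on vectors is the
  componentwise order of that library; vectors of different dimensions are incomparable.
\<close>

definition minimals :: "'a::order set \<Rightarrow> 'a set" where
  "minimals S = {x \<in> S. \<forall>y \<in> S. y \<le> x \<longrightarrow> y = x}"

definition positive_vecs :: "nat \<Rightarrow> nat vec set" where
  "positive_vecs n = {d \<in> carrier_vec n. \<forall>i<n. 0 < d $ i}"


definition Z_matrix :: "real mat \<Rightarrow> bool" where
  "Z_matrix M \<longleftrightarrow> square_mat M \<and>
     (\<forall>i<dim_row M. \<forall>j<dim_row M. i \<noteq> j \<longrightarrow> M $$ (i, j) \<le> 0)"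

definition proper_principal_minors_pos :: "real mat \<Rightarrow> bool" where
  "proper_principal_minors_pos M \<longleftrightarrow>
     (\<forall>I. I \<noteq> {} \<and> I \<subset> {..<dim_row M} \<longrightarrow> 0 < det (submatrix M I I))"

definition almost_nonsingular_M_matrix :: "real mat \<Rightarrow> bool" where
  "almost_nonsingular_M_matrix M \<longleftrightarrow>
     Z_matrix M \<and> proper_principal_minors_pos M \<and> 0 \<le> det M"

definition Diag_minus :: "nat vec \<Rightarrow> nat mat \<Rightarrow> real mat" where
  "Diag_minus d L = mat_diag (dim_vec d) (\<lambda>i. real (d $ i)) - map_mat real L"

definition D_ge0 :: "nat mat \<Rightarrow> nat vec set" where
  "D_ge0 L = {d \<in> positive_vecs (dim_row L). almost_nonsingular_M_matrix (Diag_minus d L)}"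


definition insert_one :: "nat \<Rightarrow> nat vec \<Rightarrow> nat vec" where
  "insert_one s d =
     vec (Suc (dim_vec d)) (\<lambda>i. if i < s then d $ i else if i = s then 1 else d $ (i - 1))"

definition base_case :: "nat \<Rightarrow> nat \<Rightarrow> nat vec set" where
  "base_case a b = minimals
     {vec_of_list [d, max 1 (nat \<lceil>real (a * b) / real d\<rceil>)] | d. 0 < d \<and> d \<le> max 1 (a * b)}"

definition componentwise_max :: "nat \<Rightarrow> (nat \<Rightarrow> nat vec) \<Rightarrow> nat vec" where
  "componentwise_max n \<delta> = vec n (\<lambda>i. Max ((\<lambda>s. \<delta> s $ i) ` {..<n}))"

definition E_set :: "nat mat \<Rightarrow> nat vec \<Rightarrow> nat vec set" where
  "E_set L d = minimals
     {e \<in> positive_vecs (dim_row L). d \<le> e \<and> proper_principal_minors_pos (Diag_minus e L)}"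

definition det_step :: "nat mat \<Rightarrow> nat vec \<Rightarrow> nat vec set" where
  "det_step L e = minimals
     {e' \<in> positive_vecs (dim_row L). e \<le> e' \<and> 0 \<le> det (Diag_minus e' L)}"

text \<open>
  \<open>A' s\<close> is the result of the recursive call on \<open>L\<close> with row and column \<open>s\<close> deleted; \<open>\<delta>\<close> ranges over
  all tuples of the product of the sets \<open>A s\<close>.
\<close>

definition combine_step :: "nat mat \<Rightarrow> (nat \<Rightarrow> nat vec set) \<Rightarrow> nat vec set" where
  "combine_step L A' =
     (let n = dim_row L;
          A = (\<lambda>s. insert_one s ` A' s)
      in minimals (\<Union>\<delta> \<in> (\<Pi>\<^sub>E s\<in>{..<n}. A s).
                     \<Union>e \<in> E_set L (componentwise_max n \<delta>). det_step L e))"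

text \<open>The value \<open>{}\<close> for dimension less than 2 is a dummy: the recursion stops at dimension 2.\<close>

function procA :: "nat mat \<Rightarrow> nat vec set" where
  "procA L =
     (if dim_row L < 2 then {}
      else if dim_row L = 2 then base_case (L $$ (0, 1)) (L $$ (1, 0))
      else combine_step L (\<lambda>s. procA (mat_delete L s s)))"
  by pat_completeness auto
termination
  by (relation "measure dim_row") (auto simp: mat_delete_def)

text \<open>The defining equation loops as a simplification rule.\<close>

declare procA.simps [simp del]

end

theory Submission
  imports Defs
begin

text \<open>Two sets of vectors \<open>U \<subseteq> S\<close> have the same minimal elements once every element of \<open>S\<close> lies above one
  of \<open>U\<close>. Here \<open>S\<close> is \<^term>\<open>D_ge0 L\<close> and \<open>U\<close> is the union of the vectors found in the last step of the
  procedure. Increasing one diagonal entry by \<open>t\<close> adds \<open>t\<close> times a smaller principal minor to each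
  principal minor that contains it, so positivity of all proper principal minors is preserved
  upwards; this gives \<open>U \<subseteq> S\<close>. Conversely, for \<open>d\<close> in \<open>S\<close>, deleting a coordinate of \<open>d\<close> leaves a vector
  in the set belonging to the smaller matrix, which by induction lies above an output of the recursive
  call. As the deleted coordinate is at least 1, the componentwise maximum of the extended outputs is
  below \<open>d\<close>, and \<open>d\<close> is then a candidate in both minimisations.\<close>

section \<open>Minimal elements and domination\<close>

lemma minimals_eq_if_dominated:
  assumes "U \<subseteq> S" and "\<And>x. x \<in> S \<Longrightarrow> \<exists>u\<in>U. u \<le> x"
  shows "minimals U = minimals S"
proof (rule Set.set_eqI)
  fix x
  show "x \<in> minimals U \<longleftrightarrow> x \<in> minimals S"
  proof
    assume "x \<in> minimals U"
    then have x: "x \<in> U" "\<And>y. y \<in> U \<Longrightarrow> y \<le> x \<Longrightarrow> y = x"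
      unfolding minimals_def by blast+
    have "y = x" if y: "y \<in> S" "y \<le> x" for y
    proof -
      obtain u where u: "u \<in> U" "u \<le> y" using assms(2)[OF y(1)] by blast
      then have "u = x" using x(2) y(2) order_trans by blast
      then show ?thesis using u(2) y(2) order_antisym by blast
    qed
    then show "x \<in> minimals S" using x(1) assms(1) unfolding minimals_def by blast
  next
    assume "x \<in> minimals S"
    then have x: "x \<in> S" "\<And>y. y \<in> S \<Longrightarrow> y \<le> x \<Longrightarrow> y = x"
      unfolding minimals_def by blast+
    then obtain u where "u \<in> U" "u \<le> x" using assms(2) by blast
    then have "x \<in> U" using x(2) assms(1) by blast
    then show "x \<in> minimals U" using x(2) assms(1) unfolding minimals_def by blast
  qed
qed

text \<open>Descent terminates: comparable vectors have equal dimension, and passing to a strictly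
  smaller vector of naturals strictly lowers the sum of the entries. This guarantees that each
  minimisation of the procedure finds a vector below any given candidate.\<close>

lemma ex_minimals_le:
  fixes S :: "nat vec set"
  assumes "x \<in> S"
  shows "\<exists>m\<in>minimals S. m \<le> x"
  using assms
proof (induction "\<Sum>i<dim_vec x. x $ i" arbitrary: x rule: less_induct)
  case less
  show ?case
  proof (cases "x \<in> minimals S")
    case False
    then obtain y where y: "y \<in> S" "y \<le> x" "y \<noteq> x"
      using less.prems by (auto simp: minimals_def)
    then have dim: "dim_vec y = dim_vec x" and le: "\<And>i. i < dim_vec x \<Longrightarrow> y $ i \<le> x $ i"
      by (auto simp: less_eq_vec_def)
    then obtain i where "i < dim_vec x" "y $ i \<noteq> x $ i"
      using y(3) by (metis eq_vecI)
    then have "(\<Sum>i<dim_vec y. y $ i) < (\<Sum>i<dim_vec x. x $ i)"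
      unfolding dim using le by (intro sum_strict_mono_ex1) (auto simp: le_less)
    then show ?thesis
      using less.hyps y by (meson order_trans)
  qed auto
qed

section \<open>Principal minors as sums over permutations\<close>

text \<open>Summing over permutations of the index set itself makes both \<^const>\<open>submatrix\<close> and
  \<^const>\<open>mat_delete\<close> instances of reindexing along an injection.\<close>

definition principal_minor :: "(nat \<Rightarrow> nat \<Rightarrow> 'a::comm_ring_1) \<Rightarrow> nat set \<Rightarrow> 'a" where
  "principal_minor M I = (\<Sum>p | p permutes I. of_int (sign p) * (\<Prod>i\<in>I. M i (p i)))"

lemma principal_minor_empty [simp]: "principal_minor M {} = 1"
  by (simp add: principal_minor_def)

lemma principal_minor_cong:
  assumes "\<And>i j. i \<in> I \<Longrightarrow> j \<in> I \<Longrightarrow> M i j = N i j"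
  shows "principal_minor M I = principal_minor N I"
  unfolding principal_minor_def
  using assms by (intro sum.cong refl arg_cong2[where f = "(*)"] prod.cong) (auto simp: permutes_in_image)

lemma principal_minor_image:
  assumes "finite I" and "inj_on f I"
  shows "principal_minor M (f ` I) = principal_minor (\<lambda>i j. M (f i) (f j)) I"
  unfolding principal_minor_def
proof (rule sum.reindex_bij_witness[of _ "map_permutation I f" "map_permutation (f ` I) (inv_into I f)"])
  fix p assume "p \<in> {p. p permutes f ` I}"
  then have p: "p permutes f ` I" by simp
  have bij: "bij_betw (inv_into I f) (f ` I) I"
    by (simp add: assms bij_betw_inv_into inj_on_imp_bij_betw)
  show "map_permutation I f (map_permutation (f ` I) (inv_into I f) p) = p"
    by (rule map_permutation_compose_inv[OF bij p]) (auto simp: f_inv_into_f)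
  show "map_permutation (f ` I) (inv_into I f) p \<in> {p. p permutes I}"
    using map_permutation_permutes[OF bij p] by simp
  have "sign (map_permutation (f ` I) (inv_into I f) p) = sign p"
    using bij p assms by (intro sign_map_permutation) (auto simp: bij_betw_def)
  moreover have "(\<Prod>i\<in>I. M (f i) (f (map_permutation (f ` I) (inv_into I f) p i))) = (\<Prod>i\<in>f ` I. M i (p i))"
  proof -
    have "f (map_permutation (f ` I) (inv_into I f) p i) = p (f i)" if "i \<in> I" for i
    proof -
      have "map_permutation (f ` I) (inv_into I f) p (inv_into I f (f i)) = inv_into I f (p (f i))"
        using bij that by (intro map_permutation_apply) (auto simp: bij_betw_def)
      then show ?thesis
        using that assms p by (simp add: f_inv_into_f permutes_in_image)
    qed
    then show ?thesis
      by (simp add: prod.reindex assms)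
  qed
  ultimately show "of_int (sign (map_permutation (f ` I) (inv_into I f) p)) *
      (\<Prod>i\<in>I. M (f i) (f (map_permutation (f ` I) (inv_into I f) p i))) =
      of_int (sign p) * (\<Prod>i\<in>f ` I. M i (p i))" by simp
next
  fix p assume "p \<in> {p. p permutes I}"
  then have p: "p permutes I" by simp
  have bij: "bij_betw f I (f ` I)"
    by (simp add: assms inj_on_imp_bij_betw)
  show "map_permutation (f ` I) (inv_into I f) (map_permutation I f p) = p"
    by (rule map_permutation_compose_inv[OF bij p]) (auto simp: assms)
  show "map_permutation I f p \<in> {p. p permutes f ` I}"
    using map_permutation_permutes[OF bij p] by simp
qed

lemma det_eq_principal_minor:
  assumes "M \<in> carrier_mat n n"
  shows "det M = principal_minor (\<lambda>i j. M $$ (i, j)) {..<n}"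
  by (simp add: det_def'[OF assms] principal_minor_def lessThan_atLeast0)

text \<open>\<open>submatrix\<close> renumbers indices through \<open>pick I\<close>, the increasing
  enumeration of \<open>I\<close>. It is injective on \<open>{..<card I}\<close> with values in
  \<open>I\<close>, so counting shows that it reaches all of \<open>I\<close>.\<close>

lemma det_submatrix:
  assumes "M \<in> carrier_mat n n" and "I \<subseteq> {..<n}"
  shows "det (submatrix M I I) = principal_minor (\<lambda>i j. M $$ (i, j)) I"
proof -
  have I: "{i. i < n \<and> i \<in> I} = I" using assms(2) by auto
  have fin: "finite I" using assms(2) finite_subset by blast
  have inj: "inj_on (pick I) {..<card I}"
    by (auto intro!: linorder_inj_onI dest: pick_mono_le)
  then have img: "pick I ` {..<card I} = I"
    using fin by (intro card_subset_eq) (auto simp: card_image pick_in_set_le)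
  have "submatrix M I I \<in> carrier_mat (card I) (card I)"
    using assms I by (auto simp: dim_submatrix)
  then have "det (submatrix M I I) = principal_minor (\<lambda>i j. submatrix M I I $$ (i, j)) {..<card I}"
    by (rule det_eq_principal_minor)
  also have "\<dots> = principal_minor (\<lambda>i j. M $$ (pick I i, pick I j)) {..<card I}"
    using assms I by (intro principal_minor_cong submatrix_index) auto
  also have "\<dots> = principal_minor (\<lambda>i j. M $$ (i, j)) I"
    using principal_minor_image[OF _ inj, of "\<lambda>i j. M $$ (i, j)"] img by simp
  finally show ?thesis .
qed

section \<open>Increasing diagonal entries\<close>

text \<open>A determinant is affine in a single entry. The coefficient of the entry at
  \<open>(k, k)\<close> collects the permutations fixing \<open>k\<close>, which are the
  permutations of \<open>I - {k}\<close>.\<close>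

lemma principal_minor_add_diagonal_entry:
  assumes "finite I" and "k \<in> I"
  shows "principal_minor (\<lambda>i j. M i j + (if i = j \<and> i = k then t else 0)) I =
    principal_minor M I + t * principal_minor M (I - {k})"
proof -
  let ?N = "\<lambda>i j. M i j + (if i = j \<and> i = k then t else 0)"
  \<comment> \<open>Only the factor at \<open>k\<close> differs from that of \<open>M\<close>, and
    it contains \<open>t\<close> exactly when \<open>p\<close> fixes \<open>k\<close>.\<close>
  have *: "of_int (sign p) * (\<Prod>i\<in>I. ?N i (p i)) =
      of_int (sign p) * (\<Prod>i\<in>I. M i (p i)) +
      (if p k = k then t * (of_int (sign p) * (\<Prod>i\<in>I - {k}. M i (p i))) else 0)" for p
  proof -
    have "(\<Prod>i\<in>I. ?N i (p i)) = ?N k (p k) * (\<Prod>i\<in>I - {k}. ?N i (p i))"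
      using assms by (rule prod.remove)
    also have "(\<Prod>i\<in>I - {k}. ?N i (p i)) = (\<Prod>i\<in>I - {k}. M i (p i))"
      by (rule prod.cong) auto
    finally show ?thesis
      using prod.remove[OF assms, of "\<lambda>i. M i (p i)"] by (simp add: algebra_simps)
  qed
  have fixing: "{p \<in> {p. p permutes I}. p k = k} = {p. p permutes (I - {k})}"
  proof (intro equalityI subsetI)
    fix p assume "p \<in> {p \<in> {p. p permutes I}. p k = k}"
    then have "p permutes I" "\<And>x. x \<in> I - (I - {k}) \<Longrightarrow> p x = x" by auto
    then have "p permutes (I - {k})" by (rule permutes_superset)
    then show "p \<in> {p. p permutes (I - {k})}" by simp
  next
    fix p assume "p \<in> {p. p permutes (I - {k})}"
    then have "p permutes (I - {k})" by simp
    then show "p \<in> {p \<in> {p. p permutes I}. p k = k}"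
      using permutes_subset[of p "I - {k}" I] permutes_not_in[of p "I - {k}" k] by auto
  qed
  let ?g = "\<lambda>p. t * (of_int (sign p) * (\<Prod>i\<in>I - {k}. M i (p i)))"
  have "(\<Sum>p | p permutes I. if p k = k then ?g p else 0) = sum ?g {p \<in> {p. p permutes I}. p k = k}"
    using finite_permutations[OF assms(1)] by (rule sum.inter_filter[symmetric])
  also have "\<dots> = t * principal_minor M (I - {k})"
    unfolding fixing principal_minor_def by (rule sum_distrib_left[symmetric])
  finally have "(\<Sum>p | p permutes I. if p k = k then ?g p else 0) = t * principal_minor M (I - {k})" .
  then show ?thesis
    unfolding principal_minor_def[of ?N] * sum.distrib by (simp only: principal_minor_def[of M I])
qed

text \<open>The entries are raised one at a time: each step adds a non-negative multiple of a
  positive minor to a positive minor.\<close>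

lemma principal_minor_add_diagonal_pos:
  fixes M :: "nat \<Rightarrow> nat \<Rightarrow> 'a::linordered_idom"
  assumes "finite I" and "\<And>J. J \<subseteq> I \<Longrightarrow> 0 < principal_minor M J" and "\<And>i. i \<in> I \<Longrightarrow> 0 \<le> x i"
  shows "0 < principal_minor (\<lambda>i j. M i j + (if i = j then x i else 0)) I"
proof -
  \<comment> \<open>\<open>K\<close> is the set of positions raised so far. The claim ranges over
    all \<open>J\<close> within \<open>I\<close> because raising position \<open>k\<close> calls on
    the minor of \<open>J - {k}\<close> as well.\<close>
  have "0 < principal_minor (\<lambda>i j. M i j + (if i = j \<and> i \<in> K then x i else 0)) J"
    if "finite K" "K \<subseteq> I" "J \<subseteq> I" for K J
    using that
  proof (induction K arbitrary: J rule: finite_induct)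
    case empty
    then show ?case using assms(2) by simp
  next
    case (insert k K)
    let ?N = "\<lambda>i j. M i j + (if i = j \<and> i \<in> K then x i else 0)"
    have eq: "principal_minor (\<lambda>i j. M i j + (if i = j \<and> i \<in> insert k K then x i else 0)) J =
        principal_minor (\<lambda>i j. ?N i j + (if i = j \<and> i = k then x k else 0)) J"
      using insert.hyps by (intro principal_minor_cong) auto
    show ?case
    proof (cases "k \<in> J")
      case True
      have "finite J" using insert.prems assms(1) finite_subset by blast
      moreover have "0 < principal_minor ?N J" "0 < principal_minor ?N (J - {k})"
        using insert.IH[of J] insert.IH[of "J - {k}"] insert.prems by blast+
      moreover have "0 \<le> x k" using insert.prems assms(3) by auto
      ultimately show ?thesis
        unfolding eq using True
        by (simp only: principal_minor_add_diagonal_entry) (simp add: add_pos_nonneg)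
    next
      case False
      then have "principal_minor (\<lambda>i j. ?N i j + (if i = j \<and> i = k then x k else 0)) J = principal_minor ?N J"
        by (intro principal_minor_cong) auto
      then show ?thesis
        unfolding eq using insert.IH[of J] insert.prems by simp
    qed
  qed
  from this[of I I] have "0 < principal_minor (\<lambda>i j. M i j + (if i = j \<and> i \<in> I then x i else 0)) I"
    using assms(1) by simp
  also have "principal_minor (\<lambda>i j. M i j + (if i = j \<and> i \<in> I then x i else 0)) I =
      principal_minor (\<lambda>i j. M i j + (if i = j then x i else 0)) I"
    by (intro principal_minor_cong) auto
  finally show ?thesis .
qed

section \<open>The matrices Diag(d) - L\<close>

lemma Diag_minus_carrier:
  assumes "d \<in> carrier_vec n" and "L \<in> carrier_mat n n"
  shows "Diag_minus d L \<in> carrier_mat n n"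
  using assms by (simp add: Diag_minus_def minus_carrier_mat)

lemma Diag_minus_index:
  assumes "d \<in> carrier_vec n" and "L \<in> carrier_mat n n" and "i < n" and "j < n"
  shows "Diag_minus d L $$ (i, j) = (if i = j then real (d $ i) else 0) - real (L $$ (i, j))"
  using assms by (simp add: Diag_minus_def mat_diag_def)

lemma Z_matrix_Diag_minus:
  assumes "d \<in> carrier_vec n" and "L \<in> carrier_mat n n"
  shows "Z_matrix (Diag_minus d L)"
  using assms Diag_minus_carrier[OF assms] by (auto simp: Z_matrix_def Diag_minus_index)

text \<open>Replaces determinants of submatrices by sums indexed by the original positions. The
  empty set may join the quantifier because its minor is 1, which suits arguments that pass to
  arbitrary subsets.\<close>

lemma proper_principal_minors_pos_Diag_minus_iff:
  assumes "d \<in> carrier_vec n" and "L \<in> carrier_mat n n"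
  shows "proper_principal_minors_pos (Diag_minus d L) \<longleftrightarrow>
    (\<forall>I \<subset> {..<n}. 0 < principal_minor (\<lambda>i j. (if i = j then real (d $ i) else 0) - real (L $$ (i, j))) I)"
proof -
  have M: "Diag_minus d L \<in> carrier_mat n n" by (rule Diag_minus_carrier[OF assms])
  let ?M = "\<lambda>i j. (if i = j then real (d $ i) else 0) - real (L $$ (i, j))"
  have *: "det (submatrix (Diag_minus d L) I I) = principal_minor ?M I"
    if "I \<subseteq> {..<n}" for I
    unfolding det_submatrix[OF M that]
    using that by (intro principal_minor_cong Diag_minus_index[OF assms]) auto
  have dim: "dim_row (Diag_minus d L) = n"
    using M by simp
  show ?thesis
    unfolding proper_principal_minors_pos_def dim
  proof (intro iffI allI impI)
    fix I
    assume pos: "\<forall>I. I \<noteq> {} \<and> I \<subset> {..<n} \<longrightarrow> 0 < det (submatrix (Diag_minus d L) I I)"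
      and I: "I \<subset> {..<n}"
    show "0 < principal_minor ?M I"
    proof (cases "I = {}")
      case True
      then show ?thesis by simp
    next
      case False
      then have "0 < det (submatrix (Diag_minus d L) I I)" using pos I by blast
      then show ?thesis unfolding *[OF psubset_imp_subset[OF I]] .
    qed
  next
    fix I
    assume "\<forall>I\<subset>{..<n}. 0 < principal_minor ?M I" and I: "I \<noteq> {} \<and> I \<subset> {..<n}"
    then have "0 < principal_minor ?M I" by blast
    then show "0 < det (submatrix (Diag_minus d L) I I)"
      unfolding *[OF psubset_imp_subset[OF conjunct2[OF I]]] .
  qed
qed

lemma proper_principal_minors_pos_Diag_minus_mono:
  assumes "d \<in> carrier_vec n" and "L \<in> carrier_mat n n" and "d \<le> e"
    and "proper_principal_minors_pos (Diag_minus d L)"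
  shows "proper_principal_minors_pos (Diag_minus e L)"
proof -
  have dim: "dim_vec e = n"
    using assms(3) carrier_vecD[OF assms(1)] unfolding less_eq_vec_def by simp
  then have e: "e \<in> carrier_vec n"
    by (rule carrier_vecI)
  have le: "d $ i \<le> e $ i" if "i < n" for i
    using assms(3) that unfolding less_eq_vec_def dim by blast
  let ?M = "\<lambda>d i j. (if i = j then real (d $ i) else 0) - real (L $$ (i, j))"
  have "0 < principal_minor (?M e) I" if I: "I \<subset> {..<n}" for I
  proof -
    have "finite I" using I finite_subset by blast
    \<comment> \<open>The diagonal increments are the entries of \<open>e - d\<close>; every subset
      of a proper index set is again proper, so all minors required for \<open>d\<close> are
      positive.\<close>
    then have "0 < principal_minor (\<lambda>i j. ?M d i j + (if i = j then real (e $ i) - real (d $ i) else 0)) I"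
    proof (rule principal_minor_add_diagonal_pos)
      show "0 < principal_minor (?M d) J" if "J \<subseteq> I" for J
        using assms(4) subset_psubset_trans[OF that I]
        unfolding proper_principal_minors_pos_Diag_minus_iff[OF assms(1,2)] by blast
      show "0 \<le> real (e $ i) - real (d $ i)" if "i \<in> I" for i
        using le[of i] that I by auto
    qed
    also have "principal_minor (\<lambda>i j. ?M d i j + (if i = j then real (e $ i) - real (d $ i) else 0)) I =
        principal_minor (?M e) I"
      by (intro principal_minor_cong) auto
    finally show ?thesis .
  qed
  then show ?thesis
    unfolding proper_principal_minors_pos_Diag_minus_iff[OF e assms(2)] by blast
qed

text \<open>Off-diagonal entries are negated natural numbers, which settles \<open>Z_matrix\<close>
  for every \<open>d\<close>.\<close>

lemma D_ge0_iff:
  assumes "L \<in> carrier_mat n n"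
  shows "d \<in> D_ge0 L \<longleftrightarrow> d \<in> positive_vecs n \<and> proper_principal_minors_pos (Diag_minus d L) \<and>
    0 \<le> det (Diag_minus d L)"
  using assms Z_matrix_Diag_minus[of d n L]
  by (auto simp: D_ge0_def almost_nonsingular_M_matrix_def positive_vecs_def)

section \<open>The recursive step\<close>

text \<open>\<open>insert_index s\<close> skips \<open>s\<close>, so it sends every index set of the
  smaller matrix, even the full one, to a proper index set of \<open>L\<close>. Hence the smaller
  determinant is a proper principal minor of the larger matrix and is even strictly
  positive.\<close>

lemma delete_coordinate_D_ge0:
  assumes L: "L \<in> carrier_mat (Suc n) (Suc n)" and d: "d \<in> D_ge0 L" and s: "s < Suc n"
  shows "vec n (\<lambda>i. d $ insert_index s i) \<in> D_ge0 (mat_delete L s s)"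
proof -
  let ?d = "vec n (\<lambda>i. d $ insert_index s i)" and ?L = "mat_delete L s s"
  let ?M = "\<lambda>d L i j. (if i = j then real (d $ i) else 0) - real (L $$ (i, j))"
  have L': "?L \<in> carrier_mat n n" using mat_delete_carrier[OF L] by simp
  have d': "?d \<in> carrier_vec n" by simp
  have dc: "d \<in> carrier_vec (Suc n)" using d D_ge0_iff[OF L] by (auto simp: positive_vecs_def)
  have lt: "insert_index s i < Suc n" if "i < n" for i
    using that by (simp add: insert_index_def)
  have inj: "inj_on (insert_index s) A" for A by (rule insert_index_inj_on)
  have pos: "0 < principal_minor (?M ?d ?L) I" if I: "I \<subseteq> {..<n}" for I
  proof -
    have fin: "finite I" using I finite_subset by blast
    have "insert_index s ` I \<subseteq> {..<Suc n}" using I lt by blast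
    moreover have "s \<notin> insert_index s ` I" by (auto simp: insert_index_def split: if_splits)
    ultimately have "insert_index s ` I \<subset> {..<Suc n}" using s by blast
    then have "0 < principal_minor (?M d L) (insert_index s ` I)"
      using d D_ge0_iff[OF L] proper_principal_minors_pos_Diag_minus_iff[OF dc L] by blast
    also have "\<dots> = principal_minor (\<lambda>i j. ?M d L (insert_index s i) (insert_index s j)) I"
      by (rule principal_minor_image[OF fin inj])
    also have "\<dots> = principal_minor (?M ?d ?L) I"
    proof (rule principal_minor_cong)
      fix i j assume "i \<in> I" "j \<in> I"
      then have "i < n" "j < n" using I by auto
      \<comment> \<open>Injectivity of \<open>insert_index s\<close> makes the two diagonal tests
        agree.\<close>
      then show "?M d L (insert_index s i) (insert_index s j) = ?M ?d ?L i j"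
        using mat_delete_index[OF L s s] inj[of UNIV] by (simp add: inj_eq)
    qed
    finally show ?thesis .
  qed
  have "det (Diag_minus ?d ?L) = principal_minor (?M ?d ?L) {..<n}"
    unfolding det_eq_principal_minor[OF Diag_minus_carrier[OF d' L']]
    by (intro principal_minor_cong Diag_minus_index[OF d' L']) auto
  then have "0 < det (Diag_minus ?d ?L)" using pos by simp
  moreover have "proper_principal_minors_pos (Diag_minus ?d ?L)"
    using pos by (auto simp: proper_principal_minors_pos_Diag_minus_iff[OF d' L'])
  moreover have "?d \<in> positive_vecs n"
    using d lt by (auto simp: D_ge0_iff[OF L] positive_vecs_def)
  ultimately show ?thesis by (simp add: D_ge0_iff[OF L'])
qed

lemma insert_one_le:
  assumes "d \<in> positive_vecs (Suc n)" and "s < Suc n" and "u \<le> vec n (\<lambda>i. d $ insert_index s i)"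
  shows "insert_one s u \<le> d"
proof -
  have dim_d: "dim_vec d = Suc n" using assms(1) by (auto simp: positive_vecs_def)
  have dim: "dim_vec u = n" and le: "\<And>i. i < n \<Longrightarrow> u $ i \<le> d $ insert_index s i"
    using assms(3) by (auto simp: less_eq_vec_def)
  have "insert_one s u $ i \<le> d $ i" if "i < Suc n" for i
  proof -
    consider "i < s" | "i = s" | "s < i" by linarith
    then show ?thesis
    proof cases
      case 1
      then show ?thesis using le[of i] assms(2) dim by (simp add: insert_one_def)
    next
      case 2
      then show ?thesis using assms(1,2) dim by (simp add: insert_one_def positive_vecs_def Suc_leI)
    next
      case 3
      \<comment> \<open>Beyond \<open>s\<close> the coordinates are shifted by one:
        \<open>insert_index s (i - 1) = i\<close>.\<close>
      then show ?thesis using le[of "i - 1"] that dim by (simp add: insert_one_def)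
    qed
  qed
  then show ?thesis
    using dim dim_d by (simp add: less_eq_vec_def insert_one_def)
qed

lemma componentwise_max_le:
  assumes "d \<in> carrier_vec n" and "\<And>s. s < n \<Longrightarrow> \<delta> s \<le> d"
  shows "componentwise_max n \<delta> \<le> d"
proof -
  have "(MAX s\<in>{..<n}. \<delta> s $ i) \<le> d $ i" if "i < n" for i
  proof (rule Max.boundedI)
    show "(\<lambda>s. \<delta> s $ i) ` {..<n} \<noteq> {}" using that by auto
    show "x \<le> d $ i" if "x \<in> (\<lambda>s. \<delta> s $ i) ` {..<n}" for x
      using that assms \<open>i < n\<close> by (auto simp: less_eq_vec_def)
  qed simp
  then show ?thesis
    using carrier_vecD[OF assms(1)] by (simp add: less_eq_vec_def componentwise_max_def)
qed

text \<open>The recursive results enter as a family \<open>A'\<close>, so the argument is separate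
  from the recursion of \<open>procA\<close>.\<close>

lemma combine_step_minimals:
  assumes L: "L \<in> carrier_mat (Suc n) (Suc n)"
    and A': "\<And>s. s < Suc n \<Longrightarrow> A' s = minimals (D_ge0 (mat_delete L s s))"
  shows "combine_step L A' = minimals (D_ge0 L)"
proof -
  let ?T = "\<Pi>\<^sub>E s\<in>{..<Suc n}. insert_one s ` A' s"
  let ?U = "\<Union>\<delta>\<in>?T. \<Union>e\<in>E_set L (componentwise_max (Suc n) \<delta>). det_step L e"
  have dimL: "dim_row L = Suc n" using L by simp
  have "minimals ?U = minimals (D_ge0 L)"
  proof (rule minimals_eq_if_dominated)
    \<comment> \<open>The proper minors are inherited from \<open>e\<close> by monotonicity, while
      the last minimisation supplies the determinant condition.\<close>
    show "?U \<subseteq> D_ge0 L"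
    proof clarify
      fix \<delta> e e'
      assume "e \<in> E_set L (componentwise_max (Suc n) \<delta>)" and e': "e' \<in> det_step L e"
      then have "e \<in> carrier_vec (Suc n)" "proper_principal_minors_pos (Diag_minus e L)"
        by (auto simp: E_set_def minimals_def positive_vecs_def dimL)
      moreover have "e \<le> e'" "e' \<in> positive_vecs (Suc n)" "0 \<le> det (Diag_minus e' L)"
        using e' by (auto simp: det_step_def minimals_def dimL)
      ultimately show "e' \<in> D_ge0 L"
        using proper_principal_minors_pos_Diag_minus_mono[OF _ L] by (auto simp: D_ge0_iff[OF L])
    qed
  next
    fix d assume d: "d \<in> D_ge0 L"
    then have dp: "d \<in> positive_vecs (Suc n)" and dpos: "proper_principal_minors_pos (Diag_minus d L)"
      and ddet: "0 \<le> det (Diag_minus d L)"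
      by (auto simp: D_ge0_iff[OF L])
    have "\<exists>v\<in>insert_one s ` A' s. v \<le> d" if s: "s < Suc n" for s
      using ex_minimals_le[OF delete_coordinate_D_ge0[OF L d s]] insert_one_le[OF dp s]
      unfolding A'[OF s] by blast
    then obtain f where f: "\<And>s. s < Suc n \<Longrightarrow> f s \<in> insert_one s ` A' s \<and> f s \<le> d"
      by metis
    \<comment> \<open>Elements of the extensional product must be \<open>undefined\<close> outside
      the index set, hence the restriction.\<close>
    define \<delta> where "\<delta> = restrict f {..<Suc n}"
    have \<delta>: "\<delta> \<in> ?T" using f by (auto simp: \<delta>_def)
    have "componentwise_max (Suc n) \<delta> \<le> d"
      using f dp by (intro componentwise_max_le) (auto simp: \<delta>_def positive_vecs_def)
    then have "d \<in> {e \<in> positive_vecs (Suc n).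
        componentwise_max (Suc n) \<delta> \<le> e \<and> proper_principal_minors_pos (Diag_minus e L)}"
      using dp dpos by simp
    from ex_minimals_le[OF this] obtain e
      where e: "e \<in> E_set L (componentwise_max (Suc n) \<delta>)" "e \<le> d"
      unfolding E_set_def dimL by blast
    have "d \<in> {e' \<in> positive_vecs (Suc n). e \<le> e' \<and> 0 \<le> det (Diag_minus e' L)}"
      using dp ddet e(2) by simp
    from ex_minimals_le[OF this] obtain e' where "e' \<in> det_step L e" "e' \<le> d"
      unfolding det_step_def dimL by blast
    then show "\<exists>u\<in>?U. u \<le> d" by (intro bexI[of _ e'] UN_I[OF \<delta>] UN_I[OF e(1)])
  qed
  then show ?thesis by (simp add: combine_step_def dimL)
qed

section \<open>Dimension two\<close>

text \<open>With zero diagonal in \<open>L\<close>, the non-empty proper minors are the positive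
  entries of \<open>d\<close>, so only the sign of the determinant remains to be examined.\<close>

lemma D_ge0_dim_2:
  assumes L: "L \<in> carrier_mat 2 2" and diag: "L $$ (0, 0) = 0" "L $$ (1, 1) = 0"
  shows "d \<in> D_ge0 L \<longleftrightarrow> d \<in> positive_vecs 2 \<and> L $$ (0, 1) * L $$ (1, 0) \<le> d $ 0 * d $ 1"
proof (cases "d \<in> positive_vecs 2")
  case True
  then have d: "d \<in> carrier_vec 2" and pos: "0 < d $ 0" "0 < d $ 1" by (auto simp: positive_vecs_def)
  let ?M = "\<lambda>i j. (if i = j then real (d $ i) else 0) - real (L $$ (i, j))"
  have two: "{..<2} = {0, 1::nat}" by auto
  have single: "principal_minor ?M {i} = ?M i i" for i
    by (simp add: principal_minor_def)
  have "proper_principal_minors_pos (Diag_minus d L)"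
    unfolding proper_principal_minors_pos_Diag_minus_iff[OF d L]
  proof (intro allI impI)
    fix I :: "nat set" assume "I \<subset> {..<2}"
    then have "I = {} \<or> I = {0} \<or> I = {1}" unfolding two by blast
    then show "0 < principal_minor ?M I"
    proof (elim disjE)
      assume "I = {0}"
      then show ?thesis using pos diag by (simp only: single) simp
    next
      assume "I = {1}"
      then show ?thesis using pos diag by (simp only: single) simp
    qed simp
  qed
  moreover have "det (Diag_minus d L) = real (d $ 0 * d $ 1) - real (L $$ (0, 1) * L $$ (1, 0))"
  proof -
    have M: "Diag_minus d L \<in> carrier_mat 2 2" by (rule Diag_minus_carrier[OF d L])
    have "det (Diag_minus d L) = (\<Sum>j<2. Diag_minus d L $$ (0, j) * cofactor (Diag_minus d L) 0 j)"
      by (rule laplace_expansion_row[OF M]) simp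
    \<comment> \<open>Deleting row 0 and column \<open>j\<close> leaves the single entry in row 1
      and the other column, \<open>1 - j\<close>.\<close>
    moreover have "det (mat_delete (Diag_minus d L) 0 j) = Diag_minus d L $$ (1, 1 - j)" if "j = 0 \<or> j = 1" for j
    proof -
      have "mat_delete (Diag_minus d L) 0 j \<in> carrier_mat 1 1"
        using mat_delete_carrier[OF M] by simp
      then have "det (mat_delete (Diag_minus d L) 0 j) = mat_delete (Diag_minus d L) 0 j $$ (0, 0)"
        by (rule det_single)
      also have "\<dots> = Diag_minus d L $$ (1, 1 - j)"
        using M that by (auto simp: mat_delete_def)
      finally show ?thesis .
    qed
    ultimately show ?thesis
      using diag by (simp add: two cofactor_def Diag_minus_index[OF d L])
  qed
  ultimately show ?thesis
    using True unfolding D_ge0_iff[OF L] by (simp only: diff_ge_0_iff_ge of_nat_le_iff simp_thms)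
qed (simp add: D_ge0_iff[OF L])

text \<open>For a first coordinate \<open>d\<close>, the least admissible partner is the larger of 1
  and the ceiling of \<open>p / d\<close>. At \<open>d = max 1 p\<close> this partner is already 1,
  so larger first coordinates yield only dominated vectors.\<close>

lemma base_case_minimals:
  assumes L: "L \<in> carrier_mat 2 2" and diag: "L $$ (0, 0) = 0" "L $$ (1, 1) = 0"
  shows "base_case (L $$ (0, 1)) (L $$ (1, 0)) = minimals (D_ge0 L)"
proof -
  define p where "p = L $$ (0, 1) * L $$ (1, 0)"
  define v where "v d = vec_of_list [d, max 1 (nat \<lceil>real p / real d\<rceil>)]" for d
  have less_2: "i < 2 \<longleftrightarrow> i = 0 \<or> i = 1" for i :: nat by auto
  have v: "v d \<in> carrier_vec 2" "v d $ 0 = d" "v d $ 1 = max 1 (nat \<lceil>real p / real d\<rceil>)" for d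
    by (simp_all add: v_def carrier_vecI)
  have mem: "x \<in> D_ge0 L \<longleftrightarrow> x \<in> carrier_vec 2 \<and> 0 < x $ 0 \<and> 0 < x $ 1 \<and> p \<le> x $ 0 * x $ 1" for x
    unfolding D_ge0_dim_2[OF assms] positive_vecs_def less_2 p_def by blast
  have "minimals {v d | d. 0 < d \<and> d \<le> max 1 p} = minimals (D_ge0 L)"
  proof (rule minimals_eq_if_dominated)
    have "v d \<in> D_ge0 L" if d: "0 < d" for d
    proof -
      have "real p / real d \<le> real (nat \<lceil>real p / real d\<rceil>)"
        by (rule real_nat_ceiling_ge)
      also have "\<dots> \<le> real (max 1 (nat \<lceil>real p / real d\<rceil>))"
        by simp
      finally have "real p \<le> real (max 1 (nat \<lceil>real p / real d\<rceil>)) * real d"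
        using d by (simp only: pos_divide_le_eq of_nat_0_less_iff)
      then have "p \<le> max 1 (nat \<lceil>real p / real d\<rceil>) * d"
        by (simp only: of_nat_le_iff flip: of_nat_mult)
      then have "p \<le> d * max 1 (nat \<lceil>real p / real d\<rceil>)"
        by (simp only: mult.commute)
      then show ?thesis
        unfolding mem v(2,3) using v(1) d by simp
    qed
    then show "{v d | d. 0 < d \<and> d \<le> max 1 p} \<subseteq> D_ge0 L" by blast
  next
    fix x assume "x \<in> D_ge0 L"
    then have x: "x \<in> carrier_vec 2" "0 < x $ 0" "0 < x $ 1" "p \<le> x $ 0 * x $ 1"
      unfolding mem by blast+
    \<comment> \<open>The first coordinate of \<open>x\<close> is cut off at \<open>max 1 p\<close>.
      If the cut takes effect, \<open>d\<close> is at least \<open>p\<close> and any positive second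
      coordinate suffices.\<close>
    define d where "d = min (x $ 0) (max 1 p)"
    have d: "0 < d" "d \<le> max 1 p" "d \<le> x $ 0" using x(2) by (simp_all add: d_def)
    have "p \<le> x $ 1 * d"
    proof (cases "x $ 0 \<le> max 1 p")
      case True
      then show ?thesis using x(4) by (simp add: d_def mult.commute)
    next
      case False
      then have "p \<le> d" by (simp add: d_def)
      also have "d \<le> x $ 1 * d" using x(3) by simp
      finally show ?thesis .
    qed
    then have "real p \<le> real (x $ 1) * real d"
      by (simp only: of_nat_le_iff flip: of_nat_mult)
    then have "real p / real d \<le> real (x $ 1)"
      using d(1) by (simp only: pos_divide_le_eq of_nat_0_less_iff)
    then have "nat \<lceil>real p / real d\<rceil> \<le> x $ 1" by linarith
    then have "v d $ 1 \<le> x $ 1" unfolding v(3) using x(3) by simp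
    then have "v d \<le> x"
      using v(1)[of d] x(1) d(3) v(2)[of d] unfolding less_eq_vec_def by (auto simp: less_2)
    then show "\<exists>u\<in>{v d | d. 0 < d \<and> d \<le> max 1 p}. u \<le> x"
      using d(1,2) by blast
  qed
  then show ?thesis unfolding base_case_def v_def p_def .
qed

theorem theorem3p4:
  fixes L :: "nat mat" and n :: nat
  assumes "2 \<le> n"
    and "L \<in> carrier_mat n n"
    and "\<forall>i<n. L $$ (i, i) = 0"
  shows "procA L = minimals (D_ge0 L)"
  using assms
\<comment> \<open>The matrix is generalised because the recursive calls concern the matrices with
  one row and column deleted.\<close>
proof (induction n arbitrary: L rule: nat_induct_at_least)
  case base
  then have "base_case (L $$ (0, 1)) (L $$ (1, 0)) = minimals (D_ge0 L)"
    by (intro base_case_minimals) simp_all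
  then show ?case
    using base by (subst procA.simps) simp
next
  case (Suc n)
  have "procA (mat_delete L s s) = minimals (D_ge0 (mat_delete L s s))" if "s < Suc n" for s
  proof (rule Suc.IH)
    show "mat_delete L s s \<in> carrier_mat n n"
      using mat_delete_carrier[OF Suc.prems(1)] by simp
    show "\<forall>i<n. mat_delete L s s $$ (i, i) = 0"
      using Suc.prems that by (simp add: mat_delete_def)
  qed
  then have "combine_step L (\<lambda>s. procA (mat_delete L s s)) = minimals (D_ge0 L)"
    by (rule combine_step_minimals[OF Suc.prems(1)])
  \<comment> \<open>Since \<open>2 \<le> n\<close>, the dimension \<open>Suc n\<close> selects the
    recursive branch; \<open>subst\<close> unfolds the looping equation just once.\<close>
  then show ?case
    using Suc.prems(1) Suc.hyps by (subst procA.simps) simp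
qed

end
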